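(* For any $\epsilon>0$, there is a (small) compact operator $K_\epsilon$ with $\|K_\epsilon\|<\epsilon$ such that $I+K_\epsilon$ is distributionally chaotic.
   Context: Operators here are bounded linear operators on a complex Hilbert space $\mathcal{H}$, and $I$ denotes the identity operator on $\mathcal{H}$. Distributional chaos: for a continuous map $f:X\to X$ on a metric space $(X,d)$ (for an operator on a Hilbert space, $d(x,y)=\|x-y\|$), a pair $x,y\in X$, $n\in\mathbb{N}$ with $n\ge 1$ and $\tau\in\mathbb{R}$, put $F^{n}_{xy}(\tau)=\frac1n\#\{0\le i\le n-1: d(f^i(x),f^i(y))<\tau\}$, $F_{xy}(\tau)=\liminf_{n\to\infty}F^n_{xy}(\tau)$ and $F^*_{xy}(\tau)=\limsup_{n\to\infty}F^n_{xy}(\tau)$. The pair $\{x,y\}$ is distributionally chaotic if $F^*_{xy}(\tau)=1$ for all $\tau>0$ and $F_{xy}(\epsilon')=0$ for some $\epsilon'>0$. The map $f$ is distributionally chaotic if there is an uncountable subset $\Lambda\subseteq X$ such that every pair of two distinct points of $\Lambda$ is a distributionally chaotic pair.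
   Formalization: The Hilbert space is assumed infinite-dimensional; in finite dimension the claim is false, since orbits of differences under a linear operator that come arbitrarily close to 0 must converge to 0 (e.g. multiplication by a scalar on the complex line). *)

theory Defs
  imports "HOL-Analysis.Analysis"
begin

section \<open>Complex Hilbert spaces\<close>

class complex_vector = real_vector +
  fixes scaleC :: "complex \<Rightarrow> 'a \<Rightarrow> 'a" (infixr "*\<^sub>C" 75)
  assumes scaleC_add_right: "a *\<^sub>C (x + y) = a *\<^sub>C x + a *\<^sub>C y"
    and scaleC_add_left: "(a + b) *\<^sub>C x = a *\<^sub>C x + b *\<^sub>C x"
    and scaleC_scaleC: "a *\<^sub>C (b *\<^sub>C x) = (a * b) *\<^sub>C x"
    and scaleR_scaleC: "r *\<^sub>R x = complex_of_real r *\<^sub>C x"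

text \<open>
  The complex inner product is linear in the first argument. Every complex inner product
  space is a real one under the real part of its inner product, with the same norm; building
  on \<^class>\<open>real_inner\<close> makes the library's norm, metric and topology available. The lemma
  \<open>cinner_self\<close> below confirms that the norm is the one induced by the complex inner product.
\<close>

class complex_inner = complex_vector + real_inner +
  fixes cinner :: "'a \<Rightarrow> 'a \<Rightarrow> complex"
  assumes cinner_commute: "cinner x y = cnj (cinner y x)"
    and cinner_add_left: "cinner (x + y) z = cinner x z + cinner y z"
    and cinner_scaleC_left: "cinner (a *\<^sub>C x) y = a * cinner x y"
    and inner_cinner: "inner x y = Re (cinner x y)"

class complex_hilbert = complex_inner + complete_space

lemma cinner_self: "cinner x x = complex_of_real ((norm x)\<^sup>2)"
  for x :: "'a::complex_inner"
proof (rule complex_eqI)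
  show "Re (cinner x x) = Re (complex_of_real ((norm x)\<^sup>2))"
    by (simp add: power2_norm_eq_inner inner_cinner del: of_real_power)
  have "Im (cinner x x) = - Im (cinner x x)"
    using arg_cong[OF cinner_commute[of x x], of Im] by simp
  then show "Im (cinner x x) = Im (complex_of_real ((norm x)\<^sup>2))"
    by (simp del: of_real_power)
qed

global_interpretation complex_vector:
  vector_space "scaleC :: complex \<Rightarrow> 'a \<Rightarrow> 'a::complex_vector"
  defines cspan = complex_vector.span
proof
  fix x :: 'a
  show "1 *\<^sub>C x = x"
    using scaleR_scaleC[of 1 x] by simp
qed (simp_all add: scaleC_add_right scaleC_add_left scaleC_scaleC)

definition infinite_cdim :: "'a::complex_vector itself \<Rightarrow> bool" where
  "infinite_cdim _ \<longleftrightarrow> (\<nexists>B::'a set. finite B \<and> cspan B = UNIV)"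


section \<open>Operators\<close>

definition bounded_clinear :: "('a::complex_inner \<Rightarrow> 'a) \<Rightarrow> bool" where
  "bounded_clinear T \<longleftrightarrow> bounded_linear T \<and> (\<forall>c x. T (c *\<^sub>C x) = c *\<^sub>C T x)"

definition compact_operator :: "('a::complex_inner \<Rightarrow> 'a) \<Rightarrow> bool" where
  "compact_operator T \<longleftrightarrow> bounded_clinear T \<and> compact (closure (T ` cball 0 1))"


section \<open>Distributional chaos\<close>

definition dist_fraction ::
    "('a::metric_space \<Rightarrow> 'a) \<Rightarrow> 'a \<Rightarrow> 'a \<Rightarrow> real \<Rightarrow> nat \<Rightarrow> real" where
  "dist_fraction f x y \<tau> n = real (card {i. i < n \<and> dist ((f ^^ i) x) ((f ^^ i) y) < \<tau>}) / real n"

text \<open>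
  The limits are taken in \<^typ>\<open>ereal\<close> because \<^const>\<open>liminf\<close> and \<^const>\<open>limsup\<close> require a complete
  lattice; all values lie between 0 and 1. The junk value at \<open>n = 0\<close> does not affect them.
\<close>

definition lower_dist_fun :: "('a::metric_space \<Rightarrow> 'a) \<Rightarrow> 'a \<Rightarrow> 'a \<Rightarrow> real \<Rightarrow> ereal" where
  "lower_dist_fun f x y \<tau> = liminf (\<lambda>n. ereal (dist_fraction f x y \<tau> n))"

definition upper_dist_fun :: "('a::metric_space \<Rightarrow> 'a) \<Rightarrow> 'a \<Rightarrow> 'a \<Rightarrow> real \<Rightarrow> ereal" where
  "upper_dist_fun f x y \<tau> = limsup (\<lambda>n. ereal (dist_fraction f x y \<tau> n))"

definition dist_chaotic_pair :: "('a::metric_space \<Rightarrow> 'a) \<Rightarrow> 'a \<Rightarrow> 'a \<Rightarrow> bool" where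
  "dist_chaotic_pair f x y \<longleftrightarrow>
     (\<forall>\<tau>>0. upper_dist_fun f x y \<tau> = 1) \<and> (\<exists>\<epsilon>>0. lower_dist_fun f x y \<epsilon> = 0)"

definition distributionally_chaotic :: "('a::metric_space \<Rightarrow> 'a) \<Rightarrow> bool" where
  "distributionally_chaotic f \<longleftrightarrow>
     continuous_on UNIV f \<and>
     (\<exists>\<Lambda>. uncountable \<Lambda> \<and> (\<forall>x\<in>\<Lambda>. \<forall>y\<in>\<Lambda>. x \<noteq> y \<longrightarrow> dist_chaotic_pair f x y))"

end

(*
  Split a sequence of orthonormal vectors into pairs v_j, w_j and let T = I + K act by
    T v_j = r_j (v_j + b_j w_j),  T w_j = r_j w_j,  r_j = 1 - 1 / (2 m_j),
  so that T^i v_j = r_j^i (v_j + i b_j w_j). For summable b_j and 1 / m_j the operator K is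
  nuclear, hence compact, and small. The orbit of c_j v_j with c_j = 2 (j + 1) / (b_j m_j) starts
  small, has norm at least 1 for m_j / (j + 1) <= i < m_j, and finally decays to 0. If the m_j grow
  fast enough, then between the decay of the blocks j < k and the rise of block k there is a long
  time window [L_k, (k + 1) L_k) in which the orbit of x = sum_j c_j v_j is small. So x and 0 form
  a distributionally chaotic pair, and by linearity so do any two points of the line R x.
*)

theory Submission
  imports Defs
begin

text \<open>Completeness makes absolutely convergent series converge; both \<open>K\<close> and the
  vector with the irregular orbit are such series.\<close>

instance complex_hilbert \<subseteq> banach ..

section \<open>Complex inner product spaces\<close>

lemma cinner_zero_left [simp]: "cinner 0 y = 0"
  using cinner_add_left[of 0 0 y] by simp

lemma cinner_minus_left: "cinner (- x) y = - cinner x y"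
  using cinner_add_left[of x "- x" y] by (simp add: eq_neg_iff_add_eq_0 add.commute)

lemma cinner_diff_left: "cinner (x - y) z = cinner x z - cinner y z"
  using cinner_add_left[of x "- y" z] by (simp add: cinner_minus_left)

lemma cinner_sum_left: "cinner (sum f A) y = (\<Sum>i\<in>A. cinner (f i) y)"
  by (induction A rule: infinite_finite_induct) (auto simp: cinner_add_left)

lemma cinner_scaleR_left: "cinner (t *\<^sub>R x) y = of_real t * cinner x y"
  by (simp add: scaleR_scaleC cinner_scaleC_left)

lemma cinner_scaleC_right: "cinner x (a *\<^sub>C y) = cnj a * cinner x y"
  by (metis cinner_commute cinner_scaleC_left complex_cnj_mult)

text \<open>The norm axioms give homogeneity for real scalars only; the complex case follows by
  expanding \<open>cinner_self\<close>.\<close>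

lemma norm_scaleC: "norm (a *\<^sub>C x) = cmod a * norm x"
  for x :: "'a::complex_inner"
proof -
  have "complex_of_real ((norm (a *\<^sub>C x))\<^sup>2) = a * cnj a * complex_of_real ((norm x)\<^sup>2)"
    unfolding cinner_self[symmetric] by (simp add: cinner_scaleC_left cinner_scaleC_right)
  also have "\<dots> = complex_of_real ((cmod a * norm x)\<^sup>2)"
    by (simp only: complex_norm_square[symmetric] power_mult_distrib of_real_mult of_real_power)
  finally show ?thesis
    by (metis norm_ge_zero mult_nonneg_nonneg of_real_eq_iff power2_eq_imp_eq)
qed

text \<open>Cauchy-Schwarz in its complex form reduces to the real form: multiplying
  \<open>x\<close> by a suitable unimodular \<open>a\<close> turns \<open>cinner x y\<close> into
  its modulus without changing the norm of \<open>x\<close>.\<close>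

lemma norm_cinner_le: "cmod (cinner x y) \<le> norm x * norm y"
  for x y :: "'a::complex_inner"
proof (cases "cinner x y = 0")
  case False
  define a where "a = cnj (sgn (cinner x y))"
  have a: "cmod a = 1"
    using False by (simp add: a_def norm_sgn)
  have "cinner (a *\<^sub>C x) y = of_real (cmod (cinner x y))"
    using False complex_norm_square[of "cinner x y"]
    by (simp add: cinner_scaleC_left a_def sgn_eq field_simps power2_eq_square)
  then have "cmod (cinner x y) = inner (a *\<^sub>C x) y"
    by (simp add: inner_cinner)
  also have "\<dots> \<le> norm (a *\<^sub>C x) * norm y"
    by (rule norm_cauchy_schwarz)
  finally show ?thesis
    by (simp add: norm_scaleC a)
qed simp

lemma bounded_linear_cinner_left: "bounded_linear (\<lambda>x. cinner x y)"
  for y :: "'a::complex_inner"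
  by (rule bounded_linear_intro[where K = "norm y"])
    (auto simp: cinner_add_left cinner_scaleR_left norm_cinner_le scaleR_conv_of_real)

lemma bounded_linear_scaleC_left: "bounded_linear (\<lambda>a. a *\<^sub>C x)"
  for x :: "'a::complex_inner"
  by (rule bounded_linear_intro[where K = "norm x"])
    (auto simp: scaleC_add_left norm_scaleC scaleR_scaleC scaleC_scaleC scaleR_conv_of_real)

text \<open>Gram-Schmidt: finitely many vectors never span the space, so some vector differs from
  its projection onto their span, and the difference can be normalised.\<close>

lemma exists_orthonormal_sequence:
  assumes "infinite_cdim TYPE('a::complex_inner)"
  shows "\<exists>e :: nat \<Rightarrow> 'a. \<forall>m n. cinner (e m) (e n) = (if m = n then 1 else 0)"
proof -
  \<comment> \<open>Dependent choice permits conditions on earlier vectors only; orthogonality to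
    later ones is recovered from \<open>cinner_commute\<close>.\<close>
  define P where
    "P e n y \<longleftrightarrow> cinner y y = 1 \<and> (\<forall>m<n. cinner y (e m) = 0)" for e :: "nat \<Rightarrow> 'a" and n :: nat and y
  have "\<exists>e. \<forall>n. P e n (e n)"
  proof (rule dependent_wellorder_choice)
    fix n and e :: "nat \<Rightarrow> 'a"
    assume *: "P e m (e m)" if "m < n" for m
    have orth: "cinner (e i) (e j) = (if i = j then 1 else 0)" if "i < n" "j < n" for i j
    proof (cases i j rule: linorder_cases)
      case less
      then have "cinner (e j) (e i) = 0"
        using *[of j] that by (simp add: P_def)
      then show ?thesis
        using less by (subst cinner_commute) simp
    qed (use *[of i] that in \<open>simp_all add: P_def\<close>)
    have "cspan (e ` {..<n}) \<noteq> UNIV"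
      using assms unfolding infinite_cdim_def by blast
    then obtain x where x: "x \<notin> cspan (e ` {..<n})"
      by blast
    \<comment> \<open>The orthogonal projection of \<open>x\<close> onto the span of the vectors
      chosen so far.\<close>
    define p where "p = (\<Sum>i<n. cinner x (e i) *\<^sub>C e i)"
    have "p \<in> cspan (e ` {..<n})"
      unfolding p_def
      by (intro complex_vector.span_sum complex_vector.span_scale complex_vector.span_base) auto
    with x have ne: "x - p \<noteq> 0"
      by auto
    have "cinner (x - p) (e m) = 0" if "m < n" for m
    proof -
      have "cinner p (e m) = (\<Sum>i<n. if i = m then cinner x (e i) else 0)"
        unfolding p_def cinner_sum_left using that
        by (intro sum.cong) (auto simp: cinner_scaleC_left orth)
      then show ?thesis
        using that by (simp add: cinner_diff_left)
    qed
    moreover have "norm (inverse (norm (x - p)) *\<^sub>R (x - p)) = 1"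
      using ne by simp
    ultimately have "P e n (inverse (norm (x - p)) *\<^sub>R (x - p))"
      by (simp add: P_def cinner_self cinner_scaleR_left del: norm_scaleR)
    then show "\<exists>y. P e n y" ..
  qed (simp add: P_def)
  then obtain e where e: "P e n (e n)" for n
    by blast
  have "cinner (e i) (e j) = (if i = j then 1 else 0)" for i j
  proof (cases i j rule: linorder_cases)
    case less
    then have "cinner (e j) (e i) = 0"
      using e[of j] by (simp add: P_def)
    then show ?thesis
      using less by (subst cinner_commute) simp
  qed (use e[of i] in \<open>simp_all add: P_def\<close>)
  then show ?thesis
    by blast
qed

section \<open>Nuclear operators\<close>

text \<open>In a complete space it suffices to show total boundedness, and a finite net of a nearby
  compact set is also a net of \<open>S\<close>, with a larger radius.\<close>

lemma compact_closure_approximable: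
  fixes S :: "'a::complete_space set"
  assumes "\<And>d. d > 0 \<Longrightarrow> \<exists>C. compact C \<and> (\<forall>x\<in>S. \<exists>y\<in>C. dist x y \<le> d)"
  shows "compact (closure S)"
  unfolding compact_eq_totally_bounded
proof (intro conjI allI impI)
  show "complete (closure S)"
    by (simp add: complete_eq_closed)
  fix d :: real
  assume "d > 0"
  \<comment> \<open>Three errors of at most \<open>d / 4\<close> will be added: from the closure to
    \<open>S\<close>, from \<open>S\<close> to \<open>C\<close>, and from \<open>C\<close> to its
    net.\<close>
  then obtain C where C: "compact C" "\<And>x. x \<in> S \<Longrightarrow> \<exists>y\<in>C. dist x y \<le> d / 4"
    using assms[of "d / 4"] by auto
  have "\<exists>F. finite F \<and> C \<subseteq> (\<Union>x\<in>F. ball x (d / 4))"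
    using C(1) \<open>d > 0\<close> unfolding compact_eq_totally_bounded by simp
  then obtain F where F: "finite F" "C \<subseteq> (\<Union>x\<in>F. ball x (d / 4))"
    by blast
  have "closure S \<subseteq> (\<Union>x\<in>F. ball x d)"
  proof
    fix x
    assume "x \<in> closure S"
    then obtain x' where x': "x' \<in> S" "dist x' x < d / 4"
      using \<open>d > 0\<close> by (meson closure_approachable zero_less_divide_iff zero_less_numeral)
    then obtain y where y: "y \<in> C" "dist x' y \<le> d / 4"
      using C(2) by blast
    then obtain w where w: "w \<in> F" "dist w y < d / 4"
      using F(2) by auto
    have "dist w x < d"
      using x' y w dist_triangle[of w x y] dist_triangle[of y x x'] \<open>d > 0\<close>
      by (simp add: dist_commute)
    with w show "x \<in> (\<Union>x\<in>F. ball x d)"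
      by auto
  qed
  with F(1) show "\<exists>k. finite k \<and> closure S \<subseteq> (\<Union>x\<in>k. ball x d)"
    by blast
qed

text \<open>Each further term adds the image of a closed disc, and sums of compact sets are compact.
  These sets contain the images of the unit ball under the partial sums of a nuclear
  operator.\<close>

lemma compact_disc_combinations:
  fixes z :: "nat \<Rightarrow> 'a::complex_inner"
  shows "compact {\<Sum>n<N. t n *\<^sub>C z n | t. \<forall>n. cmod (t n) \<le> 1}"
proof (induction N)
  case 0
  have "{\<Sum>n<0. t n *\<^sub>C z n | t. \<forall>n. cmod (t n) \<le> 1} = {0}"
    by (auto intro: exI[of _ "\<lambda>_. 0"])
  then show ?case
    by simp
next
  case (Suc N)
  let ?S = "\<lambda>N. {\<Sum>n<N. t n *\<^sub>C z n | t. \<forall>n. cmod (t n) \<le> 1}"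
  have "compact ((\<lambda>a. a *\<^sub>C z N) ` cball 0 1)"
    by (intro compact_continuous_image linear_continuous_on bounded_linear_scaleC_left compact_cball)
  with Suc have "compact {x + y | x y. x \<in> ?S N \<and> y \<in> (\<lambda>a. a *\<^sub>C z N) ` cball 0 1}"
    by (rule compact_sums)
  also have "{x + y | x y. x \<in> ?S N \<and> y \<in> (\<lambda>a. a *\<^sub>C z N) ` cball 0 1} = ?S (Suc N)"
  proof (intro equalityI subsetI)
    fix w
    assume "w \<in> {x + y | x y. x \<in> ?S N \<and> y \<in> (\<lambda>a. a *\<^sub>C z N) ` cball 0 1}"
    then obtain t a where *: "\<forall>n. cmod (t n) \<le> 1" "cmod a \<le> 1" "w = (\<Sum>n<N. t n *\<^sub>C z n) + a *\<^sub>C z N"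
      by auto
    have "w = (\<Sum>n<Suc N. (t(N := a)) n *\<^sub>C z n)"
      using * by simp
    moreover have "\<forall>n. cmod ((t(N := a)) n) \<le> 1"
      using * by simp
    ultimately show "w \<in> ?S (Suc N)"
      by blast
  next
    fix w
    assume "w \<in> ?S (Suc N)"
    then show "w \<in> {x + y | x y. x \<in> ?S N \<and> y \<in> (\<lambda>a. a *\<^sub>C z N) ` cball 0 1}"
      by fastforce
  qed
  finally show ?case .
qed

text \<open>On the unit ball the coefficients lie in the unit disc, so the tail of the series is
  bounded uniformly by a tail of the sum of \<open>norm (z n)\<close>, while the initial part stays
  in a compact set.\<close>

lemma nuclear_operator:
  fixes u z :: "nat \<Rightarrow> 'a::complex_hilbert"
  assumes u: "\<And>n. norm (u n) \<le> 1" and z: "summable (\<lambda>n. norm (z n))"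
  defines "K \<equiv> \<lambda>x. \<Sum>n. cinner x (u n) *\<^sub>C z n"
  shows compact_operator_nuclear: "compact_operator K"
    and onorm_nuclear_le: "onorm K \<le> (\<Sum>n. norm (z n))"
proof -
  have c: "cmod (cinner x (u n)) \<le> norm x" for x n
    using norm_cinner_le[of x "u n"] mult_left_le[OF u[of n], of "norm x"] by simp
  have term_le: "norm (cinner x (u n) *\<^sub>C z n) \<le> norm x * norm (z n)" for x n
    by (simp add: norm_scaleC c mult_right_mono)
  have abs_summable: "summable (\<lambda>n. norm (cinner x (u n) *\<^sub>C z n))" for x
    by (rule summable_comparison_test'[OF summable_mult[OF z, of "norm x"]]) (simp add: term_le)
  note summable = summable_norm_cancel[OF abs_summable]
  have K_le: "norm (K x) \<le> norm x * (\<Sum>n. norm (z n))" for x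
  proof -
    have "norm (K x) \<le> (\<Sum>n. norm (cinner x (u n) *\<^sub>C z n))"
      unfolding K_def by (rule summable_norm[OF abs_summable])
    also have "\<dots> \<le> (\<Sum>n. norm x * norm (z n))"
      by (intro suminf_le term_le abs_summable summable_mult z)
    finally show ?thesis
      by (simp add: suminf_mult[OF z])
  qed
  have K_scaleC: "K (a *\<^sub>C x) = a *\<^sub>C K x" for a x
  proof -
    have "bounded_linear (\<lambda>y. a *\<^sub>C y :: 'a)"
      by (rule bounded_linear_intro[where K = "cmod a"])
        (auto simp: scaleC_add_right norm_scaleC scaleR_scaleC scaleC_scaleC mult.commute)
    from bounded_linear.suminf[OF this summable[of x]] show ?thesis
      by (simp add: K_def cinner_scaleC_left scaleC_scaleC)
  qed
  have "bounded_linear K"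
  proof (rule bounded_linear_intro)
    show "K (x + y) = K x + K y" for x y
      unfolding K_def by (simp add: cinner_add_left scaleC_add_left suminf_add summable)
  qed (auto simp: K_scaleC scaleR_scaleC intro: K_le)
  then have "bounded_clinear K"
    by (simp add: bounded_clinear_def K_scaleC)
  moreover have "compact (closure (K ` cball 0 1))"
  proof (rule compact_closure_approximable)
    fix d :: real
    assume "d > 0"
    obtain N where N: "(\<Sum>n. norm (z (n + N))) < d"
      using suminf_exist_split[OF \<open>d > 0\<close> z] by (metis abs_ge_self le_less_trans order_refl real_norm_def)
    let ?C = "{\<Sum>n<N. t n *\<^sub>C z n | t. \<forall>n. cmod (t n) \<le> 1}"
    have "\<exists>y\<in>?C. dist (K x) y \<le> d" if "norm x \<le> 1" for x
    proof
      let ?y = "\<Sum>n<N. cinner x (u n) *\<^sub>C z n"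
      show "?y \<in> ?C"
        using order_trans[OF c that] by auto
      have z': "summable (\<lambda>n. norm (z (n + N)))"
        using z by (subst summable_iff_shift)
      have s: "summable (\<lambda>n. norm (cinner x (u (n + N)) *\<^sub>C z (n + N)))"
        using abs_summable[of x] by (subst summable_iff_shift[where f = "\<lambda>n. norm (cinner x (u n) *\<^sub>C z n)"])
      have "dist (K x) ?y = norm (\<Sum>n. cinner x (u (n + N)) *\<^sub>C z (n + N))"
        unfolding K_def dist_norm by (subst suminf_split_initial_segment[OF summable, of _ N]) simp
      also have "\<dots> \<le> (\<Sum>n. norm (cinner x (u (n + N)) *\<^sub>C z (n + N)))"
        by (rule summable_norm[OF s])
      also have "\<dots> \<le> (\<Sum>n. norm (z (n + N)))"
        by (intro suminf_le s z') (simp add: norm_scaleC mult_left_le_one_le order_trans[OF c that])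
      finally show "dist (K x) ?y \<le> d"
        using N by simp
    qed
    then show "\<exists>C. compact C \<and> (\<forall>x\<in>K ` cball 0 1. \<exists>y\<in>C. dist x y \<le> d)"
      using compact_disc_combinations[where N = N and z = z] by (intro exI[of _ ?C]) auto
  qed
  ultimately show "compact_operator K"
    by (simp add: compact_operator_def)
  show "onorm K \<le> (\<Sum>n. norm (z n))"
    by (rule onorm_bound) (auto simp: suminf_nonneg z K_le mult.commute)
qed

section \<open>Distributional chaos of linear operators\<close>

lemma dist_fraction_nonneg: "0 \<le> dist_fraction f x y \<tau> n"
  by (simp add: dist_fraction_def)

lemma dist_fraction_le_1: "dist_fraction f x y \<tau> n \<le> 1"
proof -
  have "card {i. i < n \<and> dist ((f ^^ i) x) ((f ^^ i) y) < \<tau>} \<le> card {..<n}"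
    by (rule card_mono) auto
  then show ?thesis
    by (cases n) (simp_all add: dist_fraction_def)
qed

text \<open>The fractions never exceed 1, and an upper limit is at least any limit along indices
  tending to infinity. Thus one sequence of favourable times is enough.\<close>

lemma upper_dist_fun_eq_1:
  assumes g: "filterlim g at_top sequentially"
    and lim: "(\<lambda>k. dist_fraction f x y \<tau> (g k)) \<longlonglongrightarrow> 1"
  shows "upper_dist_fun f x y \<tau> = 1"
proof (rule antisym)
  show "upper_dist_fun f x y \<tau> \<le> 1"
    unfolding upper_dist_fun_def by (rule Limsup_bounded) (simp add: dist_fraction_le_1)
  have l: "(\<lambda>k. ereal (dist_fraction f x y \<tau> (g k))) \<longlonglongrightarrow> 1"
    using lim by (simp add: one_ereal_def)
  show "1 \<le> upper_dist_fun f x y \<tau>"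
  proof (rule dense_ge)
    fix c
    assume "upper_dist_fun f x y \<tau> < c"
    then have "\<forall>\<^sub>F n in sequentially. ereal (dist_fraction f x y \<tau> n) < c"
      unfolding upper_dist_fun_def by (rule Limsup_lessD)
    from eventually_compose_filterlim[OF this g]
    have "\<forall>\<^sub>F k in sequentially. ereal (dist_fraction f x y \<tau> (g k)) \<le> c"
      by eventually_elim simp
    with l show "1 \<le> c"
      using tendsto_upperbound by (metis sequentially_bot)
  qed
qed

text \<open>The dual argument: the fractions are nonnegative, and a lower limit is at most any limit
  along indices tending to infinity.\<close>

lemma lower_dist_fun_eq_0:
  assumes g: "filterlim g at_top sequentially"
    and lim: "(\<lambda>k. dist_fraction f x y \<tau> (g k)) \<longlonglongrightarrow> 0"
  shows "lower_dist_fun f x y \<tau> = 0"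
proof (rule antisym)
  show "0 \<le> lower_dist_fun f x y \<tau>"
    unfolding lower_dist_fun_def by (rule Liminf_bounded) (simp add: dist_fraction_nonneg)
  have l: "(\<lambda>k. ereal (dist_fraction f x y \<tau> (g k))) \<longlonglongrightarrow> 0"
    using lim by (simp add: zero_ereal_def)
  show "lower_dist_fun f x y \<tau> \<le> 0"
  proof (rule dense_le)
    fix c
    assume "c < lower_dist_fun f x y \<tau>"
    then have "\<forall>\<^sub>F n in sequentially. c < ereal (dist_fraction f x y \<tau> n)"
      unfolding lower_dist_fun_def by (rule less_LiminfD)
    from eventually_compose_filterlim[OF this g]
    have "\<forall>\<^sub>F k in sequentially. c \<le> ereal (dist_fraction f x y \<tau> (g k))"
      by eventually_elim simp
    with l show "c \<le> 0"
      using tendsto_lowerbound by (metis sequentially_bot)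
  qed
qed

lemma bounded_linear_funpow:
  fixes T :: "'a::real_normed_vector \<Rightarrow> 'a"
  assumes "bounded_linear T"
  shows "bounded_linear (T ^^ i)"
proof (induction i)
  case (Suc i)
  then show ?case
    using bounded_linear_compose[OF assms] by (simp add: o_def)
qed (simp add: id_def)

text \<open>The orbits of two multiples of \<open>x\<close> differ by a scalar multiple of the orbit
  of \<open>x\<close>, which only rescales the threshold. Hence the real line through
  \<open>x\<close> serves as the uncountable set.\<close>

lemma distributionally_chaotic_linearI:
  fixes T :: "'a::real_normed_vector \<Rightarrow> 'a"
  assumes T: "bounded_linear T" and chaos: "dist_chaotic_pair T x 0"
  shows "distributionally_chaotic T"
  unfolding distributionally_chaotic_def
proof (intro conjI exI ballI impI)
  show "continuous_on UNIV T"
    using T by (rule linear_continuous_on)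
  have lin: "linear (T ^^ i)" for i
    using T by (intro bounded_linear.linear bounded_linear_funpow)
  have x: "x \<noteq> 0"
  proof
    assume "x = 0"
    moreover obtain d where "d > 0" "lower_dist_fun T x 0 d = 0"
      using chaos unfolding dist_chaotic_pair_def by blast
    \<comment> \<open>The zero orbit is always closer than \<open>d\<close> to itself, so the
      fraction is 1; only \<open>n = 0\<close>, where division by zero gives 0, must be
      excluded.\<close>
    moreover have "\<forall>\<^sub>F n in sequentially. (1::ereal) \<le> ereal (dist_fraction T 0 0 d n)" if "d > 0"
      using eventually_gt_at_top[of 0]
      by eventually_elim (use that in \<open>simp add: dist_fraction_def\<close>)
    ultimately show False
      using Liminf_bounded[of 1 "\<lambda>n. ereal (dist_fraction T 0 0 d n)" sequentially]
      by (simp add: lower_dist_fun_def)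
  qed
  then have "inj (\<lambda>t::real. t *\<^sub>R x)"
    by (auto simp: inj_on_def)
  then show "uncountable (range (\<lambda>t::real. t *\<^sub>R x))"
    using countable_image_inj_on uncountable_UNIV_real by blast
  fix y z
  assume "y \<in> range (\<lambda>t. t *\<^sub>R x)" "z \<in> range (\<lambda>t. t *\<^sub>R x)" "y \<noteq> z"
  then obtain s t where st: "y = s *\<^sub>R x" "z = t *\<^sub>R x" "s \<noteq> t"
    by auto
  have "dist ((T ^^ i) y) ((T ^^ i) z) = \<bar>s - t\<bar> * dist ((T ^^ i) x) ((T ^^ i) 0)" for i
    unfolding st dist_norm
    by (simp add: linear_scale[OF lin] linear_0[OF lin] flip: scaleR_diff_left)
  then have frac: "dist_fraction T y z \<tau> = dist_fraction T x 0 (\<tau> / \<bar>s - t\<bar>)" for \<tau>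
    using st(3) by (simp add: dist_fraction_def fun_eq_iff field_simps)
  obtain d where d: "d > 0" "lower_dist_fun T x 0 d = 0"
    using chaos unfolding dist_chaotic_pair_def by blast
  show "dist_chaotic_pair T y z"
    unfolding dist_chaotic_pair_def
  proof (intro conjI allI impI exI)
    show "upper_dist_fun T y z \<tau> = 1" if "\<tau> > 0" for \<tau>
      using chaos that st(3) by (simp add: dist_chaotic_pair_def upper_dist_fun_def frac)
    show "lower_dist_fun T y z (\<bar>s - t\<bar> * d) = 0"
      using d st(3) by (simp add: lower_dist_fun_def frac)
    show "\<bar>s - t\<bar> * d > 0"
      using d st(3) by simp
  qed
qed

text \<open>The window from \<open>L k\<close> to \<open>Suc k * L k\<close> fills all but
  \<open>1 / Suc k\<close> of the time up to its end, which drives the upper function to 1. Before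
  \<open>m k\<close>, distances below 1 can occur only during roughly the first
  \<open>m k / Suc k\<close> steps, which drives the lower function to 0.\<close>

lemma dist_chaotic_pair_windows:
  fixes L m :: "nat \<Rightarrow> nat"
  assumes L: "\<And>k. L k > 0"
    and small: "\<And>k i. L k \<le> i \<Longrightarrow> i < Suc k * L k \<Longrightarrow> dist ((f ^^ i) x) ((f ^^ i) y) \<le> \<eta> k"
    and \<eta>: "\<eta> \<longlonglongrightarrow> 0"
    and m: "\<And>k. k < m k"
    and large: "\<And>k i. i < m k \<Longrightarrow> m k \<le> Suc k * i \<Longrightarrow> 1 \<le> dist ((f ^^ i) x) ((f ^^ i) y)"
  shows "dist_chaotic_pair f x y"
proof -
  have "upper_dist_fun f x y \<tau> = 1" if "\<tau> > 0" for \<tau>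
  proof (rule upper_dist_fun_eq_1)
    have "k \<le> Suc k * L k" for k
      using L[of k] by (cases "L k") auto
    then show "filterlim (\<lambda>k. Suc k * L k) at_top sequentially"
      by (intro filterlim_at_top_mono[OF filterlim_ident]) auto
    show "(\<lambda>k. dist_fraction f x y \<tau> (Suc k * L k)) \<longlonglongrightarrow> 1"
    proof (rule tendsto_sandwich)
      show "\<forall>\<^sub>F k in sequentially. 1 - 1 / real (Suc k) \<le> dist_fraction f x y \<tau> (Suc k * L k)"
        using order_tendstoD(2)[OF \<eta> that]
      proof eventually_elim
        case (elim k)
        have "card {L k..<Suc k * L k} \<le> card {i. i < Suc k * L k \<and> dist ((f ^^ i) x) ((f ^^ i) y) < \<tau>}"
          using elim small[of k] by (intro card_mono) force+
        then have "real (Suc k * L k - L k) / real (Suc k * L k) \<le> dist_fraction f x y \<tau> (Suc k * L k)"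
          unfolding dist_fraction_def by (intro divide_right_mono) (simp_all only: card_atLeastLessThan of_nat_le_iff of_nat_0_le_iff)
        moreover have "real (Suc k * L k - L k) = real k * real (L k)"
          by simp
        moreover have "real k * real (L k) / real (Suc k * L k) = 1 - 1 / real (Suc k)"
          using L[of k] by (simp add: divide_simps add_nonneg_eq_0_iff) (simp add: algebra_simps)
        ultimately show ?case
          by simp
      qed
      show "(\<lambda>k. 1 - 1 / real (Suc k)) \<longlonglongrightarrow> 1"
        using tendsto_diff[OF tendsto_const[of 1] LIMSEQ_inverse_real_of_nat] by (simp add: inverse_eq_divide)
    qed (auto simp: dist_fraction_le_1)
  qed
  moreover have "lower_dist_fun f x y 1 = 0"
  proof (rule lower_dist_fun_eq_0)
    show "filterlim m at_top sequentially"
      by (intro filterlim_at_top_mono[OF filterlim_ident]) (simp add: m less_imp_le)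
    show "(\<lambda>k. dist_fraction f x y 1 (m k)) \<longlonglongrightarrow> 0"
    proof (rule tendsto_sandwich[where f = "\<lambda>_. 0"])
      show "\<forall>\<^sub>F k in sequentially. dist_fraction f x y 1 (m k) \<le> 2 * inverse (real (Suc k))"
      proof (intro always_eventually allI)
        fix k
        have "{i. i < m k \<and> dist ((f ^^ i) x) ((f ^^ i) y) < 1} \<subseteq> {..m k div Suc k}"
        proof safe
          fix i
          assume "i < m k" "dist ((f ^^ i) x) ((f ^^ i) y) < 1"
          then have "Suc k * i < m k"
            using large[of i k] by force
          then show "i \<le> m k div Suc k"
            by (simp add: less_eq_div_iff_mult_less_eq mult.commute)
        qed
        then have "card {i. i < m k \<and> dist ((f ^^ i) x) ((f ^^ i) y) < 1} \<le> card {..m k div Suc k}"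
          by (intro card_mono) auto
        then have "real (card {i. i < m k \<and> dist ((f ^^ i) x) ((f ^^ i) y) < 1}) \<le> real (m k div Suc k) + 1"
          by simp
        \<comment> \<open>The additional 1, due to counting time 0, is absorbed because
          \<open>k < m k\<close> gives \<open>Suc k \<le> m k\<close>.\<close>
        also have "\<dots> \<le> real (m k) / real (Suc k) + real (m k) / real (Suc k)"
          using m[of k] by (intro add_mono of_nat_div_le_of_nat) (simp add: field_simps)
        finally have "dist_fraction f x y 1 (m k) \<le> (2 * (real (m k) / real (Suc k))) / real (m k)"
          unfolding dist_fraction_def by (intro divide_right_mono) auto
        also have "\<dots> = 2 * inverse (real (Suc k))"
          using m[of k] by (simp add: field_simps del: of_nat_Suc)
        finally show "dist_fraction f x y 1 (m k) \<le> 2 * inverse (real (Suc k))" .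
      qed
      show "(\<lambda>k. 2 * inverse (real (Suc k))) \<longlonglongrightarrow> 0"
        using tendsto_mult_right_zero[OF LIMSEQ_inverse_real_of_nat] .
    qed (auto simp: dist_fraction_nonneg)
  qed
  ultimately show ?thesis
    unfolding dist_chaotic_pair_def using zero_less_one by blast
qed

section \<open>Time scales of the two-dimensional blocks\<close>

text \<open>Bounds the norm of \<open>T\<^sup>i (c\<^sub>j v\<^sub>j)\<close>, in the notation of the introduction.\<close>

definition block_bound :: "real \<Rightarrow> nat \<Rightarrow> nat \<Rightarrow> nat \<Rightarrow> real" where
  "block_bound b j m i =
     2 * real (Suc j) / (b * real m) * (1 + real i * b) * (1 - 1 / (2 * real m)) ^ i"

text \<open>For fixed \<open>m\<close> the geometric decay beats the linear growth.\<close>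

lemma block_bound_tendsto_0:
  assumes "m > 0"
  shows "block_bound b j m \<longlonglongrightarrow> 0"
proof -
  define r where "r = 1 - 1 / (2 * real m)"
  have "norm r < 1"
    using assms by (auto simp: r_def abs_less_iff field_simps)
  then have "(\<lambda>i. 2 * real (Suc j) / (b * real m) * (r ^ i + b * (real i * r ^ i))) \<longlonglongrightarrow> 2 * real (Suc j) / (b * real m) * (0 + b * 0)"
    by (intro tendsto_intros LIMSEQ_power_zero powser_times_n_limit_0)
  moreover have "block_bound b j m = (\<lambda>i. 2 * real (Suc j) / (b * real m) * (r ^ i + b * (real i * r ^ i)))"
    unfolding block_bound_def fun_eq_iff r_def[symmetric] by (simp add: distrib_left distrib_right mult_ac)
  ultimately show ?thesis
    by simp
qed

text \<open>Before time \<open>N\<close> the bound is at most a constant divided by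
  \<open>m\<close>, so a large \<open>m\<close> postpones the rise of a block beyond any prescribed
  time.\<close>

lemma block_bound_uniform_small:
  assumes "b > 0" "d > 0"
  shows "\<forall>\<^sub>F m in sequentially. \<forall>i<N. block_bound b j m i \<le> d"
proof -
  have "(\<lambda>m. 2 * real (Suc j) / b * (1 + real N * b) * inverse (real m)) \<longlonglongrightarrow> 0"
    by (intro tendsto_mult_right_zero lim_inverse_n)
  from order_tendstoD(2)[OF this \<open>d > 0\<close>] eventually_gt_at_top[of 0]
  show ?thesis
  proof eventually_elim
    case (elim m)
    show ?case
    proof (intro allI impI)
      fix i
      assume "i < N"
      have "block_bound b j m i \<le> 2 * real (Suc j) / (b * real m) * (1 + real N * b) * 1"
        unfolding block_bound_def using assms elim(2) \<open>i < N\<close>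
        by (intro mult_mono power_le_one mult_nonneg_nonneg add_mono mult_right_mono) (auto simp: field_simps)
      also have "\<dots> = 2 * real (Suc j) / b * (1 + real N * b) * inverse (real m)"
        by (simp add: field_simps)
      finally show "block_bound b j m i \<le> d"
        using elim(1) by simp
    qed
  qed
qed

text \<open>The order of choice matters: \<open>L k\<close> comes first, late enough for the earlier
  blocks to have decayed, and then \<open>m k\<close>, large enough for block \<open>k\<close> to
  stay small until \<open>Suc k * L k\<close>. The bound \<open>1 / real (m k) \<le> b k\<close>
  later controls the diagonal part of the perturbation.\<close>

lemma exists_time_scales:
  fixes b :: "nat \<Rightarrow> real"
  assumes b: "\<And>j. b j > 0"
  obtains L m :: "nat \<Rightarrow> nat" where "\<And>k. L k > 0" "mono L"
    "\<And>k i. L k \<le> i \<Longrightarrow> (\<Sum>j<k. block_bound (b j) j (m j) i) \<le> inverse (real (Suc k))"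
    "\<And>k i. i < Suc k * L k \<Longrightarrow> block_bound (b k) k (m k) i \<le> (1/2) ^ k"
    "\<And>k. k < m k" "\<And>k. 1 / real (m k) \<le> b k"
proof -
  define P where "P g k p \<longleftrightarrow> (case p of (L, m) \<Rightarrow> 0 < L \<and> (\<forall>j<k. fst (g j) \<le> L) \<and>
    (\<forall>i\<ge>L. (\<Sum>j<k. block_bound (b j) j (snd (g j)) i) \<le> inverse (real (Suc k))) \<and>
    (\<forall>i < Suc k * L. block_bound (b k) k m i \<le> (1/2) ^ k) \<and> k < m \<and> 1 / real m \<le> b k)"
    for g :: "nat \<Rightarrow> nat \<times> nat" and k p
  have "\<exists>g. \<forall>k. P g k (g k)"
  proof (rule dependent_wellorder_choice)
    fix k and g :: "nat \<Rightarrow> nat \<times> nat"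
    assume *: "P g j (g j)" if "j < k" for j
    have "(\<lambda>i. \<Sum>j<k. block_bound (b j) j (snd (g j)) i) \<longlonglongrightarrow> (\<Sum>j<k. 0)"
    proof (intro tendsto_sum block_bound_tendsto_0)
      show "0 < snd (g j)" if "j \<in> {..<k}" for j
        using *[of j] that by (simp add: P_def case_prod_unfold)
    qed
    then have "\<forall>\<^sub>F i in sequentially. (\<Sum>j<k. block_bound (b j) j (snd (g j)) i) < inverse (real (Suc k))"
      by (rule order_tendstoD(2)) simp
    then obtain L0 where L0: "\<And>i. i \<ge> L0 \<Longrightarrow> (\<Sum>j<k. block_bound (b j) j (snd (g j)) i) < inverse (real (Suc k))"
      unfolding eventually_sequentially by blast
    \<comment> \<open>The sum dominates every earlier value, which yields monotonicity;
      \<open>Suc\<close> ensures positivity.\<close>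
    define L where "L = Suc (L0 + (\<Sum>j<k. fst (g j)))"
    have L: "fst (g j) \<le> L" if "j < k" for j
      using member_le_sum[of j "{..<k}" "\<lambda>j. fst (g j)"] that by (simp add: L_def)
    have "\<forall>\<^sub>F m in sequentially. inverse (real m) < b k"
      using order_tendstoD(2)[OF lim_inverse_n b] .
    moreover have "\<forall>\<^sub>F m in sequentially. \<forall>i < Suc k * L. block_bound (b k) k m i \<le> (1/2) ^ k"
      by (rule block_bound_uniform_small[OF b]) simp
    ultimately have "\<forall>\<^sub>F m in sequentially.
        (\<forall>i < Suc k * L. block_bound (b k) k m i \<le> (1/2) ^ k) \<and> k < m \<and> 1 / real m \<le> b k"
      using eventually_gt_at_top[of k] by eventually_elim (simp add: inverse_eq_divide)
    then obtain m where "(\<forall>i < Suc k * L. block_bound (b k) k m i \<le> (1/2) ^ k) \<and> k < m \<and> 1 / real m \<le> b k"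
      using eventually_happens'[OF sequentially_bot] by blast
    moreover have "(\<Sum>j<k. block_bound (b j) j (snd (g j)) i) \<le> inverse (real (Suc k))" if "L \<le> i" for i
      using L0[of i] that by (simp only: L_def less_imp_le Suc_le_eq add_leD1)
    moreover have "0 < L"
      by (simp add: L_def)
    ultimately have "P g k (L, m)"
      using L unfolding P_def by blast
    then show "\<exists>p. P g k p" ..
  qed (auto simp: P_def)
  then obtain g where g: "P g k (g k)" for k
    by blast
  have "mono (\<lambda>k. fst (g k))"
  proof (rule monoI)
    show "fst (g j) \<le> fst (g k)" if "j \<le> k" for j k
      using g[of k] that by (cases "j = k") (simp_all add: P_def case_prod_unfold)
  qed
  then show ?thesis
    using that[of "\<lambda>k. fst (g k)" "\<lambda>k. snd (g k)"] g by (simp add: P_def case_prod_unfold)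
qed

section \<open>A small compact perturbation of the identity with an irregular orbit\<close>

theorem proposition3p5:
  fixes \<epsilon> :: real
  assumes "infinite_cdim TYPE('a::complex_hilbert)"
    and "\<epsilon> > 0"
  shows "\<exists>K :: 'a \<Rightarrow> 'a. compact_operator K \<and> onorm K < \<epsilon> \<and>
           distributionally_chaotic (\<lambda>x. x + K x)"
proof -
  obtain e :: "nat \<Rightarrow> 'a" where e: "\<And>m n. cinner (e m) (e n) = (if m = n then 1 else 0)"
    using exists_orthonormal_sequence[OF assms(1)] by blast
  have norm_e [simp]: "norm (e n) = 1" for n
  proof -
    have "complex_of_real ((norm (e n))\<^sup>2) = of_real 1"
      unfolding cinner_self[symmetric] by (simp add: e)
    then show ?thesis
      by (simp only: of_real_eq_iff power2_eq_1_iff) (use norm_ge_zero[of "e n"] in linarith)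
  qed
  \<comment> \<open>The vectors \<open>z (2 * j)\<close> and \<open>z (2 * j + 1)\<close> below have
    norms at most \<open>b j\<close> and \<open>2 * b j\<close>. This scaling puts both under
    \<open>\<epsilon> / 2 * (1/2) ^ Suc n\<close> at their index \<open>n\<close>, so all norms add
    up to at most \<open>\<epsilon> / 2\<close>.\<close>
  define b where "b j = \<epsilon> / 16 * (1/4) ^ j" for j :: nat
  have b: "b j > 0" for j
    using assms(2) by (simp add: b_def)
  obtain L m :: "nat \<Rightarrow> nat" where L: "\<And>k. L k > 0" and "mono L"
    and old: "\<And>k i. L k \<le> i \<Longrightarrow> (\<Sum>j<k. block_bound (b j) j (m j) i) \<le> inverse (real (Suc k))"
    and new: "\<And>k i. i < Suc k * L k \<Longrightarrow> block_bound (b k) k (m k) i \<le> (1/2) ^ k"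
    and m: "\<And>k. k < m k" "\<And>k. 1 / real (m k) \<le> b k"
    by (rule exists_time_scales[of b, OF b], rule that; blast)
  \<comment> \<open>Close enough to 1 that \<open>r j ^ i\<close> is at least one half for
    \<open>i < m j\<close>, yet below 1, so that the block finally decays.\<close>
  define r where "r j = 1 - 1 / (2 * real (m j))" for j
  have r: "0 \<le> r j" "r j \<le> 1" for j
    using m(1)[of j] by (simp_all add: r_def field_simps)
  have r_eq: "\<bar>r j - 1\<bar> \<le> b j" for j
  proof -
    have "1 / (2 * real (m j)) \<le> 1 / real (m j)"
      by (simp add: divide_simps)
    with m(2)[of j] show ?thesis
      unfolding r_def by simp
  qed

  \<comment> \<open>The compact operator\<close>
  define v where "v j = e (Suc (2 * j))" for j
  define w where "w j = e (2 * j)" for j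
  \<comment> \<open>The prescribed value of \<open>K\<close> at \<open>e n\<close>: even indices are
    the vectors \<open>w j\<close>, odd ones the vectors \<open>v j\<close>, and for odd
    \<open>n\<close> the vector \<open>e (n - 1)\<close> is the partner \<open>w j\<close>.\<close>
  define z where "z n = (if even n then (r (n div 2) - 1) *\<^sub>R e n
    else (r (n div 2) - 1) *\<^sub>R e n + (r (n div 2) * b (n div 2)) *\<^sub>R e (n - 1))" for n
  have quarter: "(1/2 :: real) ^ (2 * j) = (1/4) ^ j" for j
    by (simp add: power_mult power2_eq_square)
  have z_le: "norm (z n) \<le> \<epsilon> / 2 * (1/2) ^ Suc n" for n
  proof (cases "even n")
    case True
    then obtain j where j: "n = 2 * j" ..
    have "norm (z n) \<le> b j"
      using r_eq[of j] by (simp add: z_def j)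
    also have "\<dots> \<le> \<epsilon> / 2 * (1/2) ^ Suc n"
      using assms(2) by (simp add: j b_def quarter)
    finally show ?thesis .
  next
    case False
    then obtain j where j: "n = Suc (2 * j)"
      by (metis oddE Suc_eq_plus1)
    have "norm (z n) \<le> norm ((r j - 1) *\<^sub>R e n) + norm ((r j * b j) *\<^sub>R e (n - 1))"
      using norm_triangle_ineq[of "(r j - 1) *\<^sub>R e n" "(r j * b j) *\<^sub>R e (n - 1)"] by (simp add: z_def j)
    also have "\<dots> \<le> b j + 1 * b j"
      using r_eq[of j] r[of j] b[of j] by (intro add_mono) (simp_all add: abs_mult mult_left_le_one_le)
    also have "\<dots> \<le> \<epsilon> / 2 * (1/2) ^ Suc n"
      using assms(2) by (simp add: j b_def quarter)
    finally show ?thesis .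
  qed
  have geom: "(\<lambda>n. \<epsilon> / 2 * (1/2) ^ Suc n) sums (\<epsilon> / 2 * 1)"
    by (intro sums_mult power_half_series)
  have z: "summable (\<lambda>n. norm (z n))"
    by (rule summable_comparison_test'[OF sums_summable[OF geom]]) (simp only: real_norm_def abs_norm_cancel z_le)
  define K where "K x = (\<Sum>n. cinner x (e n) *\<^sub>C z n)" for x
  have K: "compact_operator K" and "onorm K \<le> (\<Sum>n. norm (z n))"
    unfolding K_def using nuclear_operator[of e z] z by simp_all
  moreover have "(\<Sum>n. norm (z n)) \<le> \<epsilon> / 2"
    using suminf_le[OF z_le z sums_summable[OF geom]] sums_unique[OF geom] by simp
  ultimately have "onorm K < \<epsilon>"
    using assms(2) by simp

  \<comment> \<open>Orbits of the blocks\<close>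
  define T where "T x = x + K x" for x
  have "bounded_linear T"
    unfolding T_def using K
    by (intro bounded_linear_add bounded_linear_ident) (simp add: compact_operator_def bounded_clinear_def)
  then have T_lin: "linear T"
    by (rule bounded_linear.linear)
  note T_pow = bounded_linear_funpow[OF \<open>bounded_linear T\<close>]
  have "K (e n) = z n" for n
  proof -
    have "(\<lambda>i. cinner (e n) (e i) *\<^sub>C z i) = (\<lambda>i. if i = n then z i else 0)"
      by (auto simp: e)
    then show ?thesis
      unfolding K_def using sums_unique[OF sums_single[of n z]] by simp
  qed
  then have Tv: "T (v j) = r j *\<^sub>R (v j + b j *\<^sub>R w j)" and Tw: "T (w j) = r j *\<^sub>R w j" for j
    by (simp_all add: T_def v_def w_def z_def algebra_simps)
  have T_pow_v: "(T ^^ i) (v j) = r j ^ i *\<^sub>R (v j + (real i * b j) *\<^sub>R w j)" for i j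
  proof (induction i)
    case (Suc i)
    then show ?case
      by (simp add: linear_scale[OF T_lin] linear_add[OF T_lin] Tv Tw algebra_simps)
  qed simp
  \<comment> \<open>Half of the product of \<open>c j\<close> and \<open>real i * b j\<close> equals
    \<open>real (Suc j) * real i / real (m j)\<close>, which reaches 1 exactly when
    \<open>m j \<le> Suc j * i\<close>.\<close>
  define c where "c j = 2 * real (Suc j) / (b j * real (m j))" for j
  have c: "c j \<ge> 0" for j
    using b[of j] by (simp add: c_def)
  have block_le: "norm (c j *\<^sub>R (T ^^ i) (v j)) \<le> block_bound (b j) j (m j) i" for i j
  proof -
    have "norm (v j + (real i * b j) *\<^sub>R w j) \<le> 1 + real i * b j"
      using b[of j] norm_triangle_ineq[of "v j" "(real i * b j) *\<^sub>R w j"] by (simp add: v_def w_def abs_mult)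
    then have "norm (c j *\<^sub>R (T ^^ i) (v j)) \<le> c j * r j ^ i * (1 + real i * b j)"
      using c[of j] r[of j] by (simp add: T_pow_v abs_mult mult_left_mono)
    then show ?thesis
      by (simp add: block_bound_def c_def r_def mult_ac)
  qed
  have half: "summable (\<lambda>n. (1/2) ^ n :: real)"
    by (simp add: summable_geometric)
  \<comment> \<open>The window ends \<open>Suc j * L j\<close> do not decrease with
    \<open>j\<close>, so before the end of window \<open>k\<close> no block from \<open>k\<close> on
    has risen.\<close>
  have bound_late: "block_bound (b j) j (m j) i \<le> (1/2) ^ j" if "k \<le> j" "i < Suc k * L k" for i j k
  proof (rule new)
    have "Suc k * L k \<le> Suc j * L j"
      using that(1) monoD[OF \<open>mono L\<close> that(1)] by (intro mult_le_mono) auto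
    with that(2) show "i < Suc j * L j"
      by simp
  qed
  have summable_block: "summable (\<lambda>j. block_bound (b j) j (m j) i)" for i
  \<comment> \<open>Since \<open>i < Suc i * L i\<close>, all blocks beyond \<open>i\<close> are
    still in their early phase at time \<open>i\<close> and have a geometric bound.\<close>
  proof (rule summable_comparison_test'[OF half, of "Suc i"])
    fix j
    assume "Suc i \<le> j"
    moreover have "i < Suc i * L i"
      using L[of i] by (cases "L i") auto
    ultimately show "norm (block_bound (b j) j (m j) i) \<le> (1/2) ^ j"
      using bound_late[of i j i] order_trans[OF norm_ge_zero block_le[of j i]] by simp
  qed
  have summable_norm_T: "summable (\<lambda>j. norm (c j *\<^sub>R (T ^^ i) (v j)))" for i
    by (rule summable_comparison_test'[OF summable_block[of i]]) (use block_le in simp)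

  \<comment> \<open>The vector with the irregular orbit\<close>
  define x where "x = (\<Sum>j. c j *\<^sub>R v j)"
  have T_x: "(T ^^ i) x = (\<Sum>j. c j *\<^sub>R (T ^^ i) (v j))" for i
    unfolding x_def using bounded_linear.suminf[OF T_pow summable_norm_cancel[OF summable_norm_T[of 0]], of i]
    by (simp add: linear_scale[OF bounded_linear.linear[OF T_pow]])
  have "dist_chaotic_pair T x 0"
  proof (rule dist_chaotic_pair_windows[OF L _ _ m(1)])
    have T_0: "(T ^^ i) 0 = 0" for i
      using T_pow by (intro linear_0 bounded_linear.linear)
    \<comment> \<open>Inside window \<open>k\<close> the blocks before \<open>k\<close> contribute
      at most \<open>inverse (real (Suc k))\<close> by \<open>old\<close>, the others a geometric
      tail of total \<open>2 * (1/2) ^ k\<close>.\<close>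
    show "dist ((T ^^ i) x) ((T ^^ i) 0) \<le> inverse (real (Suc k)) + 2 * (1/2) ^ k"
      if "L k \<le> i" "i < Suc k * L k" for k i
    proof -
      have "norm ((T ^^ i) x) \<le> (\<Sum>j. block_bound (b j) j (m j) i)"
        unfolding T_x by (intro order_trans[OF summable_norm[OF summable_norm_T]] suminf_le block_le summable_norm_T summable_block)
      also have "\<dots> = (\<Sum>j. block_bound (b (j + k)) (j + k) (m (j + k)) i) + (\<Sum>j<k. block_bound (b j) j (m j) i)"
        by (rule suminf_split_initial_segment[OF summable_block])
      also have "\<dots> \<le> (\<Sum>j. (1/2) ^ k * (1/2) ^ j) + inverse (real (Suc k))"
      proof (intro add_mono old suminf_le)
        show "block_bound (b (j + k)) (j + k) (m (j + k)) i \<le> (1/2) ^ k * (1/2) ^ j" for j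
          using bound_late[of k "j + k" i] that by (simp add: power_add mult.commute)
        show "summable (\<lambda>j. block_bound (b (j + k)) (j + k) (m (j + k)) i)"
          using summable_block[of i] by (subst summable_iff_shift[where f = "\<lambda>j. block_bound (b j) j (m j) i"])
      qed (use that half in \<open>auto intro: summable_mult\<close>)
      also have "(\<Sum>j. (1/2) ^ k * (1/2) ^ j :: real) = 2 * (1/2) ^ k"
        by (simp add: suminf_mult[OF half] suminf_geometric)
      finally show ?thesis
        by (simp add: dist_norm T_0)
    qed
    show "(\<lambda>k. inverse (real (Suc k)) + 2 * (1/2) ^ k) \<longlonglongrightarrow> 0"
      using tendsto_add[OF LIMSEQ_inverse_real_of_nat tendsto_mult_right_zero[OF LIMSEQ_power_zero, of "1/2 :: real" 2]]
      by simp
    show "1 \<le> dist ((T ^^ i) x) ((T ^^ i) 0)" if "i < m k" "m k \<le> Suc k * i" for k i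
    proof -
      \<comment> \<open>Pairing with \<open>w k\<close> isolates block \<open>k\<close> by
        orthogonality, so the other blocks cannot cancel its growth.\<close>
      have coeff: "cinner (c j *\<^sub>R (T ^^ i) (v j)) (w k) = (if j = k then of_real (c k * (r k ^ i * (real i * b k))) else 0)" for j
      proof -
        have "Suc (2 * j) \<noteq> 2 * k"
          by presburger
        then have "cinner (v j) (w k) = 0" "cinner (w j) (w k) = (if j = k then 1 else 0)"
          by (simp_all add: v_def w_def e)
        then show ?thesis
          by (simp add: T_pow_v cinner_scaleR_left cinner_add_left)
      qed
      have "cinner ((T ^^ i) x) (w k) = (\<Sum>j. cinner (c j *\<^sub>R (T ^^ i) (v j)) (w k))"
        unfolding T_x by (rule bounded_linear.suminf[OF bounded_linear_cinner_left summable_norm_cancel[OF summable_norm_T]])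
      also have "\<dots> = of_real (c k * (r k ^ i * (real i * b k)))"
        unfolding coeff using sums_unique[OF sums_single[of k "\<lambda>k. complex_of_real (c k * (r k ^ i * (real i * b k)))"]]
        by (simp cong: if_cong)
      finally have "cmod (cinner ((T ^^ i) x) (w k)) = c k * (r k ^ i * (real i * b k))"
        using c[of k] r[of k] b[of k] by (simp add: norm_mult norm_power)
      moreover have "c k * (1 / 2 * (real i * b k)) \<le> c k * (r k ^ i * (real i * b k))"
      proof -
        \<comment> \<open>Bernoulli's inequality bounds \<open>r k ^ i\<close> below by
          \<open>1 - i / (2 * m k)\<close>, and \<open>i < m k\<close>.\<close>
        have "1 / 2 \<le> 1 + real i * (- (1 / (2 * real (m k))))"
          using that(1) by (simp add: field_simps)
        also have "\<dots> \<le> r k ^ i"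
          unfolding r_def diff_conv_add_uminus using m(1)[of k] by (intro Bernoulli_inequality) (simp add: field_simps)
        finally show ?thesis
          using c[of k] b[of k] by (intro mult_left_mono mult_right_mono) auto
      qed
      moreover have "1 \<le> c k * (1 / 2 * (real i * b k))"
      proof -
        have "real (m k) \<le> real (Suc k) * real i"
          using that(2) by (metis of_nat_le_iff of_nat_mult)
        then have "1 \<le> real (Suc k) * real i / real (m k)"
          using m(1)[of k] by (simp add: field_simps)
        also have "\<dots> = c k * (1 / 2 * (real i * b k))"
          using b[of k] by (simp add: c_def del: of_nat_Suc)
        finally show ?thesis .
      qed
      moreover have "cmod (cinner ((T ^^ i) x) (w k)) \<le> norm ((T ^^ i) x)"
        using norm_cinner_le[of "(T ^^ i) x" "w k"] by (simp add: w_def)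
      ultimately show ?thesis
        by (simp add: dist_norm T_0)
    qed
  qed
  then have "distributionally_chaotic T"
    by (rule distributionally_chaotic_linearI[OF \<open>bounded_linear T\<close>])
  then show ?thesis
    using K \<open>onorm K < \<epsilon>\<close> unfolding T_def by blast
qed

end
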